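(* Denote by $c_{\mathrm{eff}}$ the effective damping coefficient of the variable-order fractional vibrator $$m\frac{d^{\alpha(\omega)}x(t)}{dt^{\alpha(\omega)}}+c\frac{d^{\beta(\omega)}x(t)}{dt^{\beta(\omega)}}+k\frac{d^{\lambda(\omega)}x(t)}{dt^{\lambda(\omega)}}=f(t),\qquad 1<\alpha(\omega)<3,\ 0<\beta(\omega)<2,\ 0\le\lambda(\omega)<1.$$ Then $$c_{\mathrm{eff}}=m\omega^{\alpha(\omega)-1}\sin\frac{\alpha(\omega)\pi}{2}+c\omega^{\beta(\omega)-1}\sin\frac{\beta(\omega)\pi}{2}+k\omega^{\lambda(\omega)-1}\sin\frac{\lambda(\omega)\pi}{2}.$$
   Context: $m,c,k>0$ are constants (primary mass, damping coefficient, stiffness), $\omega>0$ is the vibration frequency, and $\alpha,\beta,\lambda$ are real functions of $\omega$. Derivatives of fractional order are Weyl derivatives: the Fourier transform of the derivative of order $v(\omega)$ of $x$ is $(i\omega)^{v(\omega)}X(\omega)$, with principal value $i^v=\cos\frac{v\pi}{2}+i\sin\frac{v\pi}{2}$. The vibrator's equivalent motion equation (the left-hand sides having equal Fourier transforms, with $\omega$-dependent coefficients acting by multiplication in the Fourier domain) is $$-\left[m\omega^{\alpha-2}\cos\frac{\alpha\pi}{2}+c\omega^{\beta-2}\cos\frac{\beta\pi}{2}\right]\frac{d^2x}{dt^2}+\left[m\omega^{\alpha-1}\sin\frac{\alpha\pi}{2}+c\omega^{\beta-1}\sin\frac{\beta\pi}{2}+k\omega^{\lambda-1}\sin\frac{\lambda\pi}{2}\right]\frac{dx}{dt}+k\omega^{\lambda}\cos\frac{\lambda\pi}{2}\,x=f(t),$$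 where $\alpha=\alpha(\omega)$, $\beta=\beta(\omega)$, $\lambda=\lambda(\omega)$. The effective damping coefficient is by definition the coefficient of $x'(t)$ in this equivalent equation. *)

theory Defs
  imports "HOL-Analysis.Analysis"
begin

definition fourier :: "(real \<Rightarrow> real) \<Rightarrow> real \<Rightarrow> complex" where
  "fourier x \<omega> = (LINT t|lborel. complex_of_real (x t) * exp (- (\<i> * of_real \<omega> * of_real t)))"

text \<open>Motions for which x, x' and x'' all have an absolutely convergent Fourier integral.\<close>

definition motion :: "(real \<Rightarrow> real) \<Rightarrow> bool" where
  "motion x \<longleftrightarrow>
     (\<forall>t. x differentiable (at t)) \<and>
     (\<forall>t. deriv x differentiable (at t)) \<and>
     continuous_on UNIV (deriv (deriv x)) \<and>
     integrable lborel x \<and> integrable lborel (deriv x) \<and> integrable lborel (deriv (deriv x))"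

text \<open>
  The Weyl derivative of variable order v(\<omega>) is given by its Fourier transform. For an arbitrary
  order function v the symbol below need not be the transform of a function of time, so the
  derivative is represented in the Fourier domain only. The complex power is the principal one:
  for \<omega> > 0 its base is on the positive imaginary axis, hence
  i^v = cos (v pi / 2) + i sin (v pi / 2).
\<close>

definition weyl_deriv_hat :: "(real \<Rightarrow> real) \<Rightarrow> (real \<Rightarrow> real) \<Rightarrow> real \<Rightarrow> complex" where
  "weyl_deriv_hat v x \<omega> = (\<i> * complex_of_real \<omega>) powr complex_of_real (v \<omega>) * fourier x \<omega>"

definition vibrator_lhs_hat ::
  "real \<Rightarrow> real \<Rightarrow> real \<Rightarrow> (real \<Rightarrow> real) \<Rightarrow> (real \<Rightarrow> real) \<Rightarrow> (real \<Rightarrow> real)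
     \<Rightarrow> (real \<Rightarrow> real) \<Rightarrow> real \<Rightarrow> complex" where
  "vibrator_lhs_hat m c k \<alpha> \<beta> lam x \<omega> =
     of_real m * weyl_deriv_hat \<alpha> x \<omega> + of_real c * weyl_deriv_hat \<beta> x \<omega>
     + of_real k * weyl_deriv_hat lam x \<omega>"

text \<open>
  Fourier transform of M x'' + C x' + K x, the real frequency-dependent coefficients
  acting by multiplication in the Fourier domain.
\<close>

definition second_order_lhs_hat ::
  "(real \<Rightarrow> real) \<Rightarrow> (real \<Rightarrow> real) \<Rightarrow> (real \<Rightarrow> real) \<Rightarrow> (real \<Rightarrow> real) \<Rightarrow> real \<Rightarrow> complex" where
  "second_order_lhs_hat M C K x \<omega> =
     of_real (M \<omega>) * fourier (deriv (deriv x)) \<omega> + of_real (C \<omega>) * fourier (deriv x) \<omega>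
     + of_real (K \<omega>) * fourier x \<omega>"

text \<open>
  The two equations share the right-hand side f, so they are equivalent when their left-hand sides
  have the same Fourier transform, for every motion x and every vibration frequency.
\<close>

definition equivalent_motion_equation ::
  "real \<Rightarrow> real \<Rightarrow> real \<Rightarrow> (real \<Rightarrow> real) \<Rightarrow> (real \<Rightarrow> real) \<Rightarrow> (real \<Rightarrow> real)
     \<Rightarrow> (real \<Rightarrow> real) \<Rightarrow> (real \<Rightarrow> real) \<Rightarrow> (real \<Rightarrow> real) \<Rightarrow> bool" where
  "equivalent_motion_equation m c k \<alpha> \<beta> lam M C K \<longleftrightarrow>
     (\<forall>x. motion x \<longrightarrow> (\<forall>\<omega>>0.
        vibrator_lhs_hat m c k \<alpha> \<beta> lam x \<omega> = second_order_lhs_hat M C K x \<omega>))"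

text \<open>
  The coefficient of x' in the equivalent equation. M and K are not determined individually,
  since x'' and x both have real symbols (- \<omega>^2 and 1), but C is determined at every \<omega> > 0.
\<close>

definition effective_damping ::
  "real \<Rightarrow> real \<Rightarrow> real \<Rightarrow> (real \<Rightarrow> real) \<Rightarrow> (real \<Rightarrow> real) \<Rightarrow> (real \<Rightarrow> real)
     \<Rightarrow> real \<Rightarrow> real" where
  "effective_damping m c k \<alpha> \<beta> lam \<omega> =
     (THE r. \<exists>M C K. equivalent_motion_equation m c k \<alpha> \<beta> lam M C K \<and> C \<omega> = r)"

end

theory Submission
  imports Defs "HOL-Probability.Probability"
begin

text \<open>
  Everything happens in the Fourier domain. A motion x and its derivatives are integrable, so x and
  x' vanish at infinity and integration by parts gives the symbol \<i> \<omega> of the time derivative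
  (lemma \<open>fourier_deriv\<close>). Hence M x'' + C x' + K x has the symbol
  (K - \<omega>^2 M) + \<i> \<omega> C, in which the damping is the only imaginary contribution.

  The fractional vibrator has the symbol m (\<i> \<omega>)^\<alpha> + c (\<i> \<omega>)^\<beta> + k (\<i> \<omega>)^\<lambda>, with
  (\<i> \<omega>)^v = \<omega>^v (cos (v \<pi>/2) + \<i> sin (v \<pi>/2)). The Gaussian is a motion whose Fourier transform has no
  zero, so two motion equations are equivalent exactly when their symbols agree at every \<omega> > 0
  (lemma \<open>equivalent_motion_equation_iff\<close>). Comparing imaginary parts and dividing by \<omega> yields the
  effective damping, and shows that it is well defined.
\<close>

section \<open>The Fourier transform of a derivative\<close>

text \<open>
  A nonzero limit would bound the function away from 0 on a half-line, which has infinite measure.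
\<close>

lemma integrable_tendsto_at_top_imp_zero:
  fixes h :: "real \<Rightarrow> 'a::{banach, second_countable_topology}"
  assumes int: "integrable lborel h" and lim: "(h \<longlongrightarrow> L) at_top"
  shows "L = 0"
proof (rule ccontr)
  assume "L \<noteq> 0"
  then have half: "norm L / 2 > 0" and "norm L / 2 < norm L"
    by auto
  from order_tendstoD(1)[OF tendsto_norm[OF lim] this(2)]
  obtain T where T: "\<And>t. t \<ge> T \<Longrightarrow> norm L / 2 < norm (h t)"
    by (auto simp: eventually_at_top_linorder)
  have "integrable lborel (\<lambda>t. indicator {T..} t * (norm L / 2))"
    by (rule Bochner_Integration.integrable_bound[OF int])
       (use half in \<open>auto simp: indicator_def intro!: AE_I2 dest!: T\<close>)
  then have "integrable lborel (\<lambda>t. indicator {T..} t * (norm L / 2) * inverse (norm L / 2))"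
    by (rule integrable_mult_left)
  then have "integrable lborel (indicator {T..} :: real \<Rightarrow> real)"
    using half by (simp add: mult.assoc \<open>L \<noteq> 0\<close>)
  then have "emeasure lborel {T..} < \<infinity>"
    by (simp add: integrable_indicator_iff)
  moreover have "emeasure lborel {T..} = \<infinity>"
  proof -
    have "of_nat n \<le> emeasure lborel {T..}" for n :: nat
    proof -
      have "of_nat n = emeasure lborel {T..T + real n}"
        by (simp add: ennreal_of_nat_eq_real_of_nat)
      also have "\<dots> \<le> emeasure lborel {T..}"
        by (rule emeasure_mono) auto
      finally show ?thesis .
    qed
    then show ?thesis
      by (metis ennreal_Ex_less_of_nat infinity_ennreal_def leD top.not_eq_extremum)
  qed
  ultimately show False by simp
qed

text \<open>
  The integral over [-y, y] is F y - F (-y). It converges as y grows, and the function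
  y \<mapsto> F y - F (-y) is itself integrable, so the limit is 0.
\<close>

lemma integral_deriv_eq_zero:
  fixes F f :: "real \<Rightarrow> 'a::euclidean_space"
  assumes deriv: "\<And>t. (F has_vector_derivative f t) (at t)"
    and cont: "continuous_on UNIV f"
    and "integrable lborel F" and int: "integrable lborel f"
  shows "(LINT t|lborel. f t) = 0"
proof (rule integrable_tendsto_at_top_imp_zero)
  have "integrable lborel (\<lambda>t. F (0 + (-1) * t))"
    using lborel_integrable_real_affine[OF \<open>integrable lborel F\<close>, of "-1" 0] by simp
  then show "integrable lborel (\<lambda>t. F t - F (- t))"
    using \<open>integrable lborel F\<close> by simp
  have "((\<lambda>y. LINT t|lborel. indicator {-y..y} t *\<^sub>R f t) \<longlongrightarrow> (LINT t|lborel. f t)) at_top"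
  proof (rule integral_dominated_convergence_at_top)
    show "AE t in lborel. ((\<lambda>y. indicator {- y..y} t *\<^sub>R f t) \<longlongrightarrow> f t) at_top"
    proof (rule AE_I2)
      fix t :: real
      have "eventually (\<lambda>y. indicator {- y..y} t *\<^sub>R f t = f t) at_top"
        using eventually_ge_at_top[of "\<bar>t\<bar>"] by eventually_elim (auto simp: indicator_def)
      then show "((\<lambda>y. indicator {- y..y} t *\<^sub>R f t) \<longlongrightarrow> f t) at_top"
        by (rule tendsto_eventually)
    qed
    show "integrable lborel (\<lambda>t. norm (f t))"
      using int by simp
    show "\<forall>\<^sub>F y in at_top. AE t in lborel. norm (indicator {- y..y} t *\<^sub>R f t) \<le> norm (f t)"
      by (auto simp: indicator_def)
  qed (use int in auto)
  moreover have "eventually (\<lambda>y. (LINT t|lborel. indicator {-y..y} t *\<^sub>R f t) = F y - F (- y)) at_top"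
    using eventually_ge_at_top[of 0]
  proof eventually_elim
    case (elim y)
    show ?case
      by (rule integral_FTC_atLeastAtMost)
         (use elim deriv cont in \<open>auto intro: has_vector_derivative_at_within continuous_on_subset\<close>)
  qed
  ultimately show "((\<lambda>t. F t - F (- t)) \<longlongrightarrow> (LINT t|lborel. f t)) at_top"
    by (rule Lim_transform_eventually)
qed

lemma integrable_fourier_integrand:
  fixes x :: "real \<Rightarrow> real"
  assumes "integrable lborel x"
  shows "integrable lborel (\<lambda>t. complex_of_real (x t) * exp (- (\<i> * of_real \<omega> * of_real t)))"
proof (rule Bochner_Integration.integrable_bound[OF assms])
  show "(\<lambda>t. complex_of_real (x t) * exp (- (\<i> * of_real \<omega> * of_real t))) \<in> borel_measurable lborel"
    using assms by measurable
qed (simp add: norm_mult norm_exp_eq_Re)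

text \<open>
  Integration by parts without boundary terms: the derivative of x t * exp (- \<i> \<omega> t) is the
  difference of the two Fourier integrands, and its integral vanishes.
\<close>

lemma fourier_deriv:
  assumes diff: "\<And>t. x differentiable (at t)" and cont: "continuous_on UNIV (deriv x)"
    and "integrable lborel x" and "integrable lborel (deriv x)"
  shows "fourier (deriv x) \<omega> = \<i> * of_real \<omega> * fourier x \<omega>"
proof -
  let ?e = "\<lambda>t. exp (- (\<i> * of_real \<omega> * complex_of_real t))"
  let ?f = "\<lambda>t. complex_of_real (deriv x t) * ?e t - \<i> * of_real \<omega> * (of_real (x t) * ?e t)"
  have contx: "continuous_on UNIV x"
    using diff by (simp add: continuous_on_eq_continuous_at differentiable_imp_continuous_within)
  have int: "integrable lborel (\<lambda>t. complex_of_real (x t) * ?e t)"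
            "integrable lborel (\<lambda>t. complex_of_real (deriv x t) * ?e t)"
    using assms by (auto intro!: integrable_fourier_integrand)
  have "(LINT t|lborel. ?f t) = 0"
  proof (rule integral_deriv_eq_zero)
    fix t
    have "(x has_vector_derivative deriv x t) (at t)"
      using diff[of t] by (simp add: DERIV_deriv_iff_real_differentiable has_real_derivative_iff_has_vector_derivative[symmetric])
    then have x: "((\<lambda>t. complex_of_real (x t)) has_vector_derivative of_real (deriv x t)) (at t)"
      by (rule bounded_linear.has_vector_derivative[OF bounded_linear_of_real])
    have "(exp \<circ> (\<lambda>z. - (\<i> * of_real \<omega> * z)) has_field_derivative
            exp (- (\<i> * of_real \<omega> * of_real t)) * (- (\<i> * of_real \<omega>))) (at (complex_of_real t))"
      unfolding o_def by (auto intro!: derivative_eq_intros)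
    then have e: "(?e has_vector_derivative ?e t * (- (\<i> * of_real \<omega>))) (at t)"
      unfolding o_def by (rule has_vector_derivative_real_field)
    show "((\<lambda>t. complex_of_real (x t) * ?e t) has_vector_derivative ?f t) (at t)"
      using has_vector_derivative_mult[OF x e] by (simp add: algebra_simps)
  next
    show "continuous_on UNIV ?f"
      by (intro continuous_intros cont contx)
  qed (use int in auto)
  then show ?thesis
    using int by (simp add: fourier_def)
qed

section \<open>A motion whose spectrum has no zero\<close>

lemma std_normal_density_has_real_derivative:
  "(std_normal_density has_real_derivative - t * std_normal_density t) (at t)"
  unfolding std_normal_density_def by (auto intro!: derivative_eq_intros simp: field_simps)

lemma deriv_std_normal_density:
  "deriv std_normal_density = (\<lambda>t. - t * std_normal_density t)"
  by (intro ext DERIV_imp_deriv std_normal_density_has_real_derivative)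

lemma deriv_std_normal_density_has_real_derivative:
  "(deriv std_normal_density has_real_derivative (t\<^sup>2 - 1) * std_normal_density t) (at t)"
  unfolding deriv_std_normal_density
  by (auto intro!: derivative_eq_intros std_normal_density_has_real_derivative
      simp: algebra_simps power2_eq_square)

lemma deriv_deriv_std_normal_density:
  "deriv (deriv std_normal_density) = (\<lambda>t. (t\<^sup>2 - 1) * std_normal_density t)"
  by (intro ext DERIV_imp_deriv deriv_std_normal_density_has_real_derivative)

lemma motion_std_normal_density: "motion std_normal_density"
  unfolding motion_def
proof (intro conjI allI)
  fix t
  show "std_normal_density differentiable (at t)"
    using std_normal_density_has_real_derivative by (auto simp: real_differentiable_def)
  show "deriv std_normal_density differentiable (at t)"
    using deriv_std_normal_density_has_real_derivative by (auto simp: real_differentiable_def)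
next
  show "continuous_on UNIV (deriv (deriv std_normal_density))"
    unfolding deriv_deriv_std_normal_density std_normal_density_def
    by (intro continuous_intros) auto
  have moment: "integrable lborel (\<lambda>t. std_normal_density t * t ^ k)" for k
    by (rule integrable_std_normal_moment)
  show "integrable lborel std_normal_density"
    using moment[of 0] by simp
  show "integrable lborel (deriv std_normal_density)"
    unfolding deriv_std_normal_density using moment[of 1] by (simp add: mult.commute)
  show "integrable lborel (deriv (deriv std_normal_density))"
    unfolding deriv_deriv_std_normal_density
    using Bochner_Integration.integrable_diff[OF moment[of 2] moment[of 0]]
    by (simp add: algebra_simps)
qed

lemma fourier_std_normal_density:
  "fourier std_normal_density \<omega> = complex_of_real (exp (- \<omega>\<^sup>2 / 2))"
proof -
  have "char std_normal_distribution (- \<omega>) =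
      (LINT t|lborel. std_normal_density t *\<^sub>R iexp (- \<omega> * t))"
    unfolding char_def by (rule integral_density) auto
  also have "\<dots> = fourier std_normal_density \<omega>"
    by (simp add: fourier_def scaleR_conv_of_real mult.assoc)
  finally show ?thesis
    by (simp add: char_std_normal_distribution)
qed

section \<open>Symbols of the motion equations\<close>

lemma imaginary_axis_powr:
  assumes "\<omega> > 0"
  shows "(\<i> * complex_of_real \<omega>) powr complex_of_real v =
    of_real (\<omega> powr v) * (of_real (cos (v * pi / 2)) + \<i> * of_real (sin (v * pi / 2)))"
proof -
  have "Ln (\<i> * complex_of_real \<omega>) = of_real (ln \<omega>) + \<i> * of_real (pi / 2)"
    using assms Ln_times_of_real[of \<omega> \<i>] by (simp add: mult.commute Ln_of_real)
  then have "(\<i> * complex_of_real \<omega>) powr complex_of_real v =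
      exp (of_real (v * ln \<omega>)) * cis (v * pi / 2)"
    using assms by (simp add: powr_def cis_conv_exp exp_add[symmetric] algebra_simps)
  also have "exp (complex_of_real (v * ln \<omega>)) = of_real (\<omega> powr v)"
    using assms by (simp add: powr_def flip: exp_of_real)
  finally show ?thesis
    by (simp add: cis.code complex_eq_iff)
qed

definition vibrator_symbol ::
  "real \<Rightarrow> real \<Rightarrow> real \<Rightarrow> (real \<Rightarrow> real) \<Rightarrow> (real \<Rightarrow> real) \<Rightarrow> (real \<Rightarrow> real) \<Rightarrow> real \<Rightarrow> complex" where
  "vibrator_symbol m c k \<alpha> \<beta> lam \<omega> =
     of_real m * (\<i> * of_real \<omega>) powr of_real (\<alpha> \<omega>)
     + of_real c * (\<i> * of_real \<omega>) powr of_real (\<beta> \<omega>)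
     + of_real k * (\<i> * of_real \<omega>) powr of_real (lam \<omega>)"

lemma vibrator_lhs_hat_eq_symbol:
  "vibrator_lhs_hat m c k \<alpha> \<beta> lam x \<omega> = vibrator_symbol m c k \<alpha> \<beta> lam \<omega> * fourier x \<omega>"
  by (simp add: vibrator_lhs_hat_def weyl_deriv_hat_def vibrator_symbol_def algebra_simps)

lemma Re_vibrator_symbol:
  assumes "\<omega> > 0"
  shows "Re (vibrator_symbol m c k \<alpha> \<beta> lam \<omega>) =
    m * \<omega> powr \<alpha> \<omega> * cos (\<alpha> \<omega> * pi / 2) + c * \<omega> powr \<beta> \<omega> * cos (\<beta> \<omega> * pi / 2)
    + k * \<omega> powr lam \<omega> * cos (lam \<omega> * pi / 2)"
  by (simp add: vibrator_symbol_def imaginary_axis_powr[OF assms])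

lemma Im_vibrator_symbol:
  assumes "\<omega> > 0"
  shows "Im (vibrator_symbol m c k \<alpha> \<beta> lam \<omega>) =
    m * \<omega> powr \<alpha> \<omega> * sin (\<alpha> \<omega> * pi / 2) + c * \<omega> powr \<beta> \<omega> * sin (\<beta> \<omega> * pi / 2)
    + k * \<omega> powr lam \<omega> * sin (lam \<omega> * pi / 2)"
  by (simp add: vibrator_symbol_def imaginary_axis_powr[OF assms])

lemma second_order_lhs_hat_eq_symbol:
  assumes "motion x"
  shows "second_order_lhs_hat M C K x \<omega> =
    (of_real (K \<omega> - \<omega>\<^sup>2 * M \<omega>) + \<i> * of_real (\<omega> * C \<omega>)) * fourier x \<omega>"
proof -
  have cont: "continuous_on UNIV (deriv x)"
    using assms by (simp add: motion_def continuous_on_eq_continuous_at differentiable_imp_continuous_within)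
  have "fourier (deriv x) \<omega> = \<i> * of_real \<omega> * fourier x \<omega>"
    using assms cont by (intro fourier_deriv) (auto simp: motion_def)
  moreover have "fourier (deriv (deriv x)) \<omega> = \<i> * of_real \<omega> * fourier (deriv x) \<omega>"
    using assms by (intro fourier_deriv) (auto simp: motion_def)
  ultimately show ?thesis
    by (simp add: second_order_lhs_hat_def algebra_simps power2_eq_square)
qed

text \<open>
  Testing with the Gaussian, whose Fourier transform can be cancelled, turns equality of the
  left-hand sides into equality of the symbols.
\<close>

lemma equivalent_motion_equation_iff:
  "equivalent_motion_equation m c k \<alpha> \<beta> lam M C K \<longleftrightarrow>
    (\<forall>\<omega>>0. K \<omega> - \<omega>\<^sup>2 * M \<omega> = Re (vibrator_symbol m c k \<alpha> \<beta> lam \<omega>) \<and>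
            \<omega> * C \<omega> = Im (vibrator_symbol m c k \<alpha> \<beta> lam \<omega>))"
proof -
  let ?S = "vibrator_symbol m c k \<alpha> \<beta> lam"
  let ?T = "\<lambda>\<omega>. of_real (K \<omega> - \<omega>\<^sup>2 * M \<omega>) + \<i> * of_real (\<omega> * C \<omega>)"
  have "equivalent_motion_equation m c k \<alpha> \<beta> lam M C K \<longleftrightarrow> (\<forall>\<omega>>0. ?S \<omega> = ?T \<omega>)"
  proof
    assume eq: "equivalent_motion_equation m c k \<alpha> \<beta> lam M C K"
    show "\<forall>\<omega>>0. ?S \<omega> = ?T \<omega>"
    proof (intro allI impI)
      fix \<omega> :: real
      assume "\<omega> > 0"
      with eq have "?S \<omega> * fourier std_normal_density \<omega> = ?T \<omega> * fourier std_normal_density \<omega>"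
        unfolding equivalent_motion_equation_def vibrator_lhs_hat_eq_symbol
        using motion_std_normal_density second_order_lhs_hat_eq_symbol by metis
      moreover have "fourier std_normal_density \<omega> \<noteq> 0"
        unfolding fourier_std_normal_density of_real_eq_0_iff by simp
      ultimately show "?S \<omega> = ?T \<omega>"
        by simp
    qed
  qed (simp add: equivalent_motion_equation_def vibrator_lhs_hat_eq_symbol
        second_order_lhs_hat_eq_symbol)
  then show ?thesis
    by (auto simp: complex_eq_iff)
qed

section \<open>The effective damping\<close>

theorem theorem2p3:
  fixes m c k :: real and \<alpha> \<beta> lam :: "real \<Rightarrow> real"
  assumes "m > 0" and "c > 0" and "k > 0"
    and "\<And>\<omega>. \<omega> > 0 \<Longrightarrow> 1 < \<alpha> \<omega> \<and> \<alpha> \<omega> < 3"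
    and "\<And>\<omega>. \<omega> > 0 \<Longrightarrow> 0 < \<beta> \<omega> \<and> \<beta> \<omega> < 2"
    and "\<And>\<omega>. \<omega> > 0 \<Longrightarrow> 0 \<le> lam \<omega> \<and> lam \<omega> < 1"
  shows "equivalent_motion_equation m c k \<alpha> \<beta> lam
      (\<lambda>\<omega>. - (m * \<omega> powr (\<alpha> \<omega> - 2) * cos (\<alpha> \<omega> * pi / 2)
             + c * \<omega> powr (\<beta> \<omega> - 2) * cos (\<beta> \<omega> * pi / 2)))
      (\<lambda>\<omega>. m * \<omega> powr (\<alpha> \<omega> - 1) * sin (\<alpha> \<omega> * pi / 2)
             + c * \<omega> powr (\<beta> \<omega> - 1) * sin (\<beta> \<omega> * pi / 2)
             + k * \<omega> powr (lam \<omega> - 1) * sin (lam \<omega> * pi / 2))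
      (\<lambda>\<omega>. k * \<omega> powr (lam \<omega>) * cos (lam \<omega> * pi / 2))
    \<and> (\<forall>\<omega>>0. effective_damping m c k \<alpha> \<beta> lam \<omega> =
          m * \<omega> powr (\<alpha> \<omega> - 1) * sin (\<alpha> \<omega> * pi / 2)
          + c * \<omega> powr (\<beta> \<omega> - 1) * sin (\<beta> \<omega> * pi / 2)
          + k * \<omega> powr (lam \<omega> - 1) * sin (lam \<omega> * pi / 2))"
    (is "equivalent_motion_equation _ _ _ _ _ _ ?M ?C ?K \<and> _")
proof
  show equiv: "equivalent_motion_equation m c k \<alpha> \<beta> lam ?M ?C ?K"
    unfolding equivalent_motion_equation_iff
    by (auto simp: Re_vibrator_symbol Im_vibrator_symbol powr_diff field_simps power2_eq_square)
  show "\<forall>\<omega>>0. effective_damping m c k \<alpha> \<beta> lam \<omega> = ?C \<omega>"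
  proof (intro allI impI)
    fix \<omega> :: real
    assume pos: "\<omega> > 0"
    show "effective_damping m c k \<alpha> \<beta> lam \<omega> = ?C \<omega>"
      unfolding effective_damping_def
    proof (rule the_equality)
      show "\<exists>M C K. equivalent_motion_equation m c k \<alpha> \<beta> lam M C K \<and> C \<omega> = ?C \<omega>"
        using equiv by (intro exI[of _ ?M] exI[of _ ?C] exI[of _ ?K] conjI refl)
    next
      fix r
      assume "\<exists>M C K. equivalent_motion_equation m c k \<alpha> \<beta> lam M C K \<and> C \<omega> = r"
      then have "\<omega> * r = Im (vibrator_symbol m c k \<alpha> \<beta> lam \<omega>)"
        using pos by (auto simp: equivalent_motion_equation_iff)
      also have "\<dots> = \<omega> * ?C \<omega>"
        using equiv pos unfolding equivalent_motion_equation_iff by simp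
      finally show "r = ?C \<omega>"
        using pos by simp
    qed
  qed
qed

end
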